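(* Let $L$ be a vocabulary with maximum relation arity $k$. If $M$ is an $L$-structure of order $n$, then $$BS(M)<\left(1-\frac{1}{2k^2+2}\right)n+k.$$ If $k=1$, then moreover $BS(M)\le n/2+1$.
   Context: A vocabulary $L$ is a finite list of relation symbols with positive integer arities; maximum relation arity = largest arity. An $L$-structure $M$ has finite universe $V(M)$ and relations $R^M:V(M)^l\to\{0,1\}$; its order is $|V(M)|$. A Bernays–Schönfinkel formula is a first-order formula (over $L\cup\{=\}$) of the form $\exists y_1\ldots\exists y_p\forall x_1\ldots\forall x_q\,\Psi$ with $p,q\ge0$ and $\Psi$ quantifier-free. A closed formula identifies an $L$-structure $M$ of order $n$ if it is true on $M$ and false on every $L$-structure of order $n$ not isomorphic to $M$. $BS(M)$ denotes the minimum total number of quantifiers $p+q$ in a Bernays–Schönfinkel formula identifying $M$. *)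

theory Defs
  imports Complex_Main
begin

text \<open>A vocabulary is the list of arities of its relation symbols; the symbols themselves are the
  positions \<open>0, \<dots>, length L - 1\<close>.\<close>

definition vocabulary :: "nat list \<Rightarrow> bool" where
  "vocabulary L \<longleftrightarrow> (\<forall>l \<in> set L. 0 < l)"

definition max_arity :: "nat list \<Rightarrow> nat" where
  "max_arity L = Max (set L)"

datatype 'a fo_struct = Struct (universe: "'a set") (rel: "nat \<Rightarrow> 'a list set")

definition fo_structure :: "nat list \<Rightarrow> 'a fo_struct \<Rightarrow> bool" where
  "fo_structure L M \<longleftrightarrow> finite (universe M) \<and>
     (\<forall>i < length L. \<forall>xs \<in> rel M i. length xs = L ! i \<and> set xs \<subseteq> universe M)"

definition order_of :: "'a fo_struct \<Rightarrow> nat" where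
  "order_of M = card (universe M)"

definition isomorphic :: "nat list \<Rightarrow> 'a fo_struct \<Rightarrow> 'b fo_struct \<Rightarrow> bool" where
  "isomorphic L M N \<longleftrightarrow> (\<exists>h. bij_betw h (universe M) (universe N) \<and>
     (\<forall>i < length L. \<forall>xs. length xs = L ! i \<and> set xs \<subseteq> universe M \<longrightarrow>
        (xs \<in> rel M i \<longleftrightarrow> map h xs \<in> rel N i)))"

datatype fm =
    FF
  | Rel nat "nat list"
  | Eq nat nat
  | Neg fm
  | Conj fm fm
  | Disj fm fm
  | Ex nat fm
  | All nat fm

primrec sat :: "'a fo_struct \<Rightarrow> (nat \<Rightarrow> 'a) \<Rightarrow> fm \<Rightarrow> bool" where
  "sat M e FF \<longleftrightarrow> False"
| "sat M e (Rel i vs) \<longleftrightarrow> map e vs \<in> rel M i"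
| "sat M e (Eq u v) \<longleftrightarrow> e u = e v"
| "sat M e (Neg \<phi>) \<longleftrightarrow> \<not> sat M e \<phi>"
| "sat M e (Conj \<phi> \<psi>) \<longleftrightarrow> sat M e \<phi> \<and> sat M e \<psi>"
| "sat M e (Disj \<phi> \<psi>) \<longleftrightarrow> sat M e \<phi> \<or> sat M e \<psi>"
| "sat M e (Ex v \<phi>) \<longleftrightarrow> (\<exists>a \<in> universe M. sat M (e(v := a)) \<phi>)"
| "sat M e (All v \<phi>) \<longleftrightarrow> (\<forall>a \<in> universe M. sat M (e(v := a)) \<phi>)"

primrec fv :: "fm \<Rightarrow> nat set" where
  "fv FF = {}"
| "fv (Rel i vs) = set vs"
| "fv (Eq u v) = {u, v}"
| "fv (Neg \<phi>) = fv \<phi>"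
| "fv (Conj \<phi> \<psi>) = fv \<phi> \<union> fv \<psi>"
| "fv (Disj \<phi> \<psi>) = fv \<phi> \<union> fv \<psi>"
| "fv (Ex v \<phi>) = fv \<phi> - {v}"
| "fv (All v \<phi>) = fv \<phi> - {v}"

primrec wf_fm :: "nat list \<Rightarrow> fm \<Rightarrow> bool" where
  "wf_fm L FF \<longleftrightarrow> True"
| "wf_fm L (Rel i vs) \<longleftrightarrow> i < length L \<and> length vs = L ! i"
| "wf_fm L (Eq u v) \<longleftrightarrow> True"
| "wf_fm L (Neg \<phi>) \<longleftrightarrow> wf_fm L \<phi>"
| "wf_fm L (Conj \<phi> \<psi>) \<longleftrightarrow> wf_fm L \<phi> \<and> wf_fm L \<psi>"
| "wf_fm L (Disj \<phi> \<psi>) \<longleftrightarrow> wf_fm L \<phi> \<and> wf_fm L \<psi>"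
| "wf_fm L (Ex v \<phi>) \<longleftrightarrow> wf_fm L \<phi>"
| "wf_fm L (All v \<phi>) \<longleftrightarrow> wf_fm L \<phi>"

primrec quantifiers :: "fm \<Rightarrow> nat" where
  "quantifiers FF = 0"
| "quantifiers (Rel i vs) = 0"
| "quantifiers (Eq u v) = 0"
| "quantifiers (Neg \<phi>) = quantifiers \<phi>"
| "quantifiers (Conj \<phi> \<psi>) = quantifiers \<phi> + quantifiers \<psi>"
| "quantifiers (Disj \<phi> \<psi>) = quantifiers \<phi> + quantifiers \<psi>"
| "quantifiers (Ex v \<phi>) = Suc (quantifiers \<phi>)"
| "quantifiers (All v \<phi>) = Suc (quantifiers \<phi>)"

definition closed_fm :: "nat list \<Rightarrow> fm \<Rightarrow> bool" where
  "closed_fm L \<phi> \<longleftrightarrow> wf_fm L \<phi> \<and> fv \<phi> = {}"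

definition bernays_schoenfinkel :: "fm \<Rightarrow> bool" where
  "bernays_schoenfinkel \<phi> \<longleftrightarrow>
     (\<exists>ys xs \<psi>. \<phi> = foldr Ex ys (foldr All xs \<psi>) \<and> quantifiers \<psi> = 0)"

text \<open>For a closed formula the assignment is irrelevant.\<close>

definition true_on :: "'a fo_struct \<Rightarrow> fm \<Rightarrow> bool" where
  "true_on M \<phi> \<longleftrightarrow> (\<forall>e. sat M e \<phi>)"

text \<open>Letting \<open>N\<close> range over the type of \<open>M\<close> loses nothing: every structure of the same order,
  over whatever type, is isomorphic to one with universe \<open>universe M\<close>.\<close>

definition identifies :: "nat list \<Rightarrow> fm \<Rightarrow> 'a fo_struct \<Rightarrow> bool" where
  "identifies L \<phi> M \<longleftrightarrow> closed_fm L \<phi> \<and> true_on M \<phi> \<and>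
     (\<forall>N :: 'a fo_struct. fo_structure L N \<and> order_of N = order_of M \<and> \<not> isomorphic L M N \<longrightarrow>
        \<not> true_on N \<phi>)"

definition BS :: "nat list \<Rightarrow> 'a fo_struct \<Rightarrow> nat" where
  "BS L M = (LEAST m. \<exists>\<phi>. bernays_schoenfinkel \<phi> \<and> identifies L \<phi> M \<and> quantifiers \<phi> = m)"

lemma sat_cong: "(\<And>v. v \<in> fv \<phi> \<Longrightarrow> e v = e' v) \<Longrightarrow> sat M e \<phi> \<longleftrightarrow> sat M e' \<phi>"
proof (induction \<phi> arbitrary: e e')
  case (Rel i vs)
  then have "map e vs = map e' vs" by simp
  then show ?case by (simp only: sat.simps)
next
  case (Conj \<phi> \<psi>)
  have "sat M e \<phi> = sat M e' \<phi>" "sat M e \<psi> = sat M e' \<psi>"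
    using Conj.prems by (auto intro!: Conj.IH)
  then show ?case by simp
next
  case (Disj \<phi> \<psi>)
  have "sat M e \<phi> = sat M e' \<phi>" "sat M e \<psi> = sat M e' \<psi>"
    using Disj.prems by (auto intro!: Disj.IH)
  then show ?case by simp
next
  case (Neg \<phi>)
  have "sat M e \<phi> = sat M e' \<phi>"
    using Neg.prems by (auto intro!: Neg.IH)
  then show ?case by simp
next
  case (Ex v \<phi>)
  have "sat M (e(v := a)) \<phi> = sat M (e'(v := a)) \<phi>" for a
    using Ex.prems by (auto intro!: Ex.IH)
  then show ?case by simp
next
  case (All v \<phi>)
  have "sat M (e(v := a)) \<phi> = sat M (e'(v := a)) \<phi>" for a
    using All.prems by (auto intro!: All.IH)
  then show ?case by simp
qed simp_all

lemma true_on_closed: "fv \<phi> = {} \<Longrightarrow> true_on M \<phi> \<longleftrightarrow> sat M e \<phi>"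
  unfolding true_on_def using sat_cong[of \<phi>] by blast

lemma sat_foldr_Ex:
  "sat M e (foldr Ex ys \<phi>) \<longleftrightarrow>
     (\<exists>e'. (\<forall>v \<in> set ys. e' v \<in> universe M) \<and> (\<forall>v. v \<notin> set ys \<longrightarrow> e' v = e v) \<and> sat M e' \<phi>)"
proof (induction ys arbitrary: e)
  case Nil
  have "e' = e" if "\<forall>v. e' v = e v" for e' using that by blast
  then show ?case by auto
next
  case (Cons y ys)
  show ?case (is "?l = ?r")
  proof
    assume ?l
    then obtain a e' where a: "a \<in> universe M" "\<forall>v \<in> set ys. e' v \<in> universe M"
      "\<forall>v. v \<notin> set ys \<longrightarrow> e' v = (e(y := a)) v" "sat M e' \<phi>"
      using Cons.IH by auto
    then have "e' y \<in> universe M" by (cases "y \<in> set ys") auto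
    with a show ?r by (intro exI[of _ e']) auto
  next
    assume ?r
    then obtain e' where e': "\<forall>v \<in> set (y # ys). e' v \<in> universe M"
      "\<forall>v. v \<notin> set (y # ys) \<longrightarrow> e' v = e v" "sat M e' \<phi>" by blast
    have "sat M (e(y := e' y)) (foldr Ex ys \<phi>)"
      unfolding Cons.IH using e' by (intro exI[of _ e']) auto
    with e'(1) show ?l by auto
  qed
qed

lemma fv_foldr_Ex: "fv (foldr Ex ys \<phi>) = fv \<phi> - set ys"
  by (induction ys) auto

lemma wf_fm_foldr_Ex: "wf_fm L (foldr Ex ys \<phi>) \<longleftrightarrow> wf_fm L \<phi>"
  by (induction ys) auto

lemma ex_conjunction:
  assumes "finite F" "\<forall>\<phi> \<in> F. wf_fm L \<phi> \<and> fv \<phi> \<subseteq> X \<and> quantifiers \<phi> = 0"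
  shows "\<exists>\<psi>. wf_fm L \<psi> \<and> fv \<psi> \<subseteq> X \<and> quantifiers \<psi> = 0 \<and>
    (\<forall>(M :: 'a fo_struct) e. sat M e \<psi> \<longleftrightarrow> (\<forall>\<phi> \<in> F. sat M e \<phi>))"
  using assms
proof (induction F rule: finite_induct)
  case empty
  show ?case by (intro exI[of _ "Neg FF"]) simp
next
  case (insert \<phi> F)
  then obtain \<psi> where "wf_fm L \<psi> \<and> fv \<psi> \<subseteq> X \<and> quantifiers \<psi> = 0 \<and>
    (\<forall>(M :: 'a fo_struct) e. sat M e \<psi> \<longleftrightarrow> (\<forall>\<phi> \<in> F. sat M e \<phi>))" by auto
  with insert.prems show ?case by (intro exI[of _ "Conj \<phi> \<psi>"]) auto
qed

text \<open>The minimum defining \<open>BS\<close> is taken over a nonempty set.\<close>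

lemma ex_identifying:
  fixes M :: "'a fo_struct"
  assumes "fo_structure L M"
  shows "\<exists>\<phi>. bernays_schoenfinkel \<phi> \<and> identifies L \<phi> M"
proof -
  define n where "n = order_of M"
  have fin: "finite (universe M)" using assms by (simp add: fo_structure_def)
  obtain f where f: "bij_betw f {..<n} (universe M)"
    using ex_bij_betw_nat_finite[OF fin] by (auto simp: n_def order_of_def atLeast0LessThan)
  define A where "A = (\<lambda>(u, v). Eq u v) ` ({..<n} \<times> {..<n}) \<union>
    (\<Union>i < length L. Rel i ` {vs. set vs \<subseteq> {..<n} \<and> length vs = L ! i})"
  define F where "F = {\<phi> \<in> A \<union> Neg ` A. sat M f \<phi>}"
  have "finite A" unfolding A_def by (auto intro!: finite_lists_length_eq)
  then have "finite F" unfolding F_def by auto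
  moreover have "\<forall>\<phi> \<in> F. wf_fm L \<phi> \<and> fv \<phi> \<subseteq> {..<n} \<and> quantifiers \<phi> = 0"
    unfolding F_def A_def by auto
  ultimately obtain \<psi> where \<psi>: "wf_fm L \<psi>" "fv \<psi> \<subseteq> {..<n}" "quantifiers \<psi> = 0"
    and sat\<psi>: "\<And>(N :: 'a fo_struct) e. sat N e \<psi> \<longleftrightarrow> (\<forall>\<phi> \<in> F. sat N e \<phi>)"
    using ex_conjunction[of F L "{..<n}"] by blast
  define \<theta> where "\<theta> = foldr Ex [0..<n] \<psi>"
  have closed: "closed_fm L \<theta>"
    using \<psi> by (auto simp: closed_fm_def \<theta>_def fv_foldr_Ex wf_fm_foldr_Ex)
  then have fv: "fv \<theta> = {}" by (simp add: closed_fm_def)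
  have "sat M f \<theta>"
    unfolding \<theta>_def sat_foldr_Ex
    using bij_betwE[OF f] by (intro exI[of _ f]) (auto simp: sat\<psi> F_def)
  then have "true_on M \<theta>" using true_on_closed[OF fv] by blast
  moreover have "isomorphic L M N"
    if N: "fo_structure L N" "order_of N = order_of M" "true_on N \<theta>" for N :: "'a fo_struct"
  proof -
    obtain e where e: "\<And>v. v < n \<Longrightarrow> e v \<in> universe N" and "sat N e \<psi>"
      using N(3) unfolding true_on_def \<theta>_def sat_foldr_Ex set_upt atLeast0LessThan
      by (meson lessThan_iff)
    then have F: "sat N e \<phi>" if "\<phi> \<in> F" for \<phi> using that sat\<psi> by blast
    have A: "sat N e \<phi> \<longleftrightarrow> sat M f \<phi>" if "\<phi> \<in> A" for \<phi>
      using F[of \<phi>] F[of "Neg \<phi>"] that by (auto simp: F_def)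
    have "inj_on e {..<n}"
    proof (rule inj_onI)
      fix u v assume uv: "u \<in> {..<n}" "v \<in> {..<n}" "e u = e v"
      then have "Eq u v \<in> A" unfolding A_def by auto
      from A[OF this] uv have "f u = f v" by simp
      with uv f show "u = v" by (meson bij_betw_def inj_onD)
    qed
    moreover have "e ` {..<n} = universe N"
    proof (rule card_subset_eq)
      show "finite (universe N)" using N(1) by (simp add: fo_structure_def)
      show "e ` {..<n} \<subseteq> universe N" using e by auto
      show "card (e ` {..<n}) = card (universe N)"
        using card_image[OF \<open>inj_on e {..<n}\<close>] N(2) by (simp add: n_def order_of_def)
    qed
    ultimately have eb: "bij_betw e {..<n} (universe N)" by (simp add: bij_betw_def)
    let ?g = "inv_into {..<n} f"
    have g: "bij_betw ?g (universe M) {..<n}" by (rule bij_betw_inv_into[OF f])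
    have "xs \<in> rel M i \<longleftrightarrow> map (e \<circ> ?g) xs \<in> rel N i"
      if "i < length L" "length xs = L ! i" "set xs \<subseteq> universe M" for i xs
    proof -
      have "set (map ?g xs) \<subseteq> {..<n}" using that(3) bij_betwE[OF g] by auto
      then have "Rel i (map ?g xs) \<in> A" using that unfolding A_def
        by (intro UnI2 UN_I[of i] imageI) auto
      from A[OF this] have "map e (map ?g xs) \<in> rel N i \<longleftrightarrow> map f (map ?g xs) \<in> rel M i"
        by (simp only: sat.simps)
      moreover have "map f (map ?g xs) = xs"
        using that(3) bij_betw_inv_into_right[OF f] by (auto intro!: map_idI)
      ultimately show ?thesis by simp
    qed
    then show ?thesis
      unfolding isomorphic_def using bij_betw_trans[OF g eb]
      by (intro exI[of _ "e \<circ> ?g"]) blast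
  qed
  moreover have "bernays_schoenfinkel \<theta>"
    unfolding bernays_schoenfinkel_def \<theta>_def
    by (intro exI[of _ "[0..<n]"] exI[of _ "[]"] exI[of _ \<psi>]) (simp add: \<psi>(3))
  ultimately show ?thesis using closed unfolding identifies_def by blast
qed

end

theory Submission
  imports Defs "HOL-Combinatorics.Transposition"
begin

text \<open>
  Call two elements similar if swapping them is an automorphism of \<open>M\<close>, and call a set \<open>B\<close> a base
  if any two elements outside \<open>B\<close> with the same quantifier-free type over \<open>B\<close> are similar. Given a
  base \<open>B\<close>, guess a copy of \<open>B\<close> existentially and let \<open>q \<ge> k\<close> universal quantifiers say that every
  \<open>q\<close>-tuple looks over this copy like some \<open>q\<close>-tuple of \<open>M\<close> over \<open>B\<close>. This identifies \<open>M\<close> as soon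
  as \<open>q\<close> exceeds the sizes of all type classes outside \<open>B\<close> (their sizes are then bounded from above,
  hence correct by counting), or there is only one class.

  Let \<open>m\<close> be the largest number of type classes over any set. Deleting from the universe one element
  of each of \<open>m\<close> classes leaves a base with singleton classes, which costs \<open>n - m + k\<close>. There
  is also a base \<open>B\<close> with at most \<open>(k\<^sup>2 - 1) m\<close> elements. It arises in \<open>k - 1\<close> stages: for
  \<open>r = k - 1, \<dots>, 1\<close>, enlarge the current set to an \<open>X\<close> over which no further \<open>r\<close> elements increase
  the number of classes, then add all classes with at most \<open>r + 1\<close> elements. A tuple that
  witnesses the dissimilarity of two elements of the same type must meet every stage, and it is too
  short for that. If \<open>s\<close> is the size of the largest class \<open>K\<close> over \<open>B\<close>, then \<open>B\<close> costs
  \<open>|B| + max k (s + 1)\<close>, and the complement of \<open>K\<close> costs \<open>n - s + k\<close>. One of the three bounds is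
  always good enough.
\<close>

section \<open>Quantifier prefixes, Boolean combinations, fibrewise counting\<close>

lemma sat_foldr_All:
  "sat M e (foldr All xs \<phi>) \<longleftrightarrow>
     (\<forall>e'. (\<forall>v \<in> set xs. e' v \<in> universe M) \<and> (\<forall>v. v \<notin> set xs \<longrightarrow> e' v = e v) \<longrightarrow> sat M e' \<phi>)"
proof -
  have neg: "sat M e (foldr All xs \<phi>) \<longleftrightarrow> \<not> sat M e (foldr Ex xs (Neg \<phi>))" for e
    by (induction xs arbitrary: e) auto
  show ?thesis unfolding neg sat_foldr_Ex by auto
qed

lemma fv_foldr_All: "fv (foldr All xs \<phi>) = fv \<phi> - set xs"
  by (induction xs) auto

lemma wf_fm_foldr_All: "wf_fm L (foldr All xs \<phi>) \<longleftrightarrow> wf_fm L \<phi>"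
  by (induction xs) auto

lemma quantifiers_foldr_Ex: "quantifiers (foldr Ex ys \<phi>) = length ys + quantifiers \<phi>"
  by (induction ys) auto

lemma quantifiers_foldr_All: "quantifiers (foldr All xs \<phi>) = length xs + quantifiers \<phi>"
  by (induction xs) auto

text \<open>Disjunctive normal form: \<open>d T\<close> conjoins the members of \<open>T\<close> and
  the negations of the rest of \<open>A\<close>, so it describes exactly the truth pattern
  \<open>T\<close>. The disjunction over \<open>TT\<close> is obtained from
  \<open>ex_conjunction\<close> by De Morgan.\<close>

lemma ex_boolean_combination:
  assumes A: "finite A" "\<forall>\<phi> \<in> A. wf_fm L \<phi> \<and> fv \<phi> \<subseteq> X \<and> quantifiers \<phi> = 0"
    and TT: "TT \<subseteq> Pow A"
  shows "\<exists>\<psi>. wf_fm L \<psi> \<and> fv \<psi> \<subseteq> X \<and> quantifiers \<psi> = 0 \<and>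
    (\<forall>(M :: 'a fo_struct) e. sat M e \<psi> \<longleftrightarrow> {\<phi> \<in> A. sat M e \<phi>} \<in> TT)"
proof -
  have "\<exists>\<psi>. wf_fm L \<psi> \<and> fv \<psi> \<subseteq> X \<and> quantifiers \<psi> = 0 \<and>
    (\<forall>(M :: 'a fo_struct) e. sat M e \<psi> \<longleftrightarrow> {\<phi> \<in> A. sat M e \<phi>} = T)" if "T \<in> TT" for T
  proof -
    have T: "T \<subseteq> A" using that TT by blast
    have "\<exists>\<psi>. wf_fm L \<psi> \<and> fv \<psi> \<subseteq> X \<and> quantifiers \<psi> = 0 \<and>
      (\<forall>(M :: 'a fo_struct) e. sat M e \<psi> \<longleftrightarrow> (\<forall>\<phi> \<in> T \<union> Neg ` (A - T). sat M e \<phi>))"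
      using A T by (intro ex_conjunction) (auto dest: finite_subset, blast)
    moreover have "(\<forall>\<phi> \<in> T \<union> Neg ` (A - T). sat M e \<phi>) \<longleftrightarrow> {\<phi> \<in> A. sat M e \<phi>} = T"
      for M :: "'a fo_struct" and e
    proof -
      have "(\<forall>\<phi> \<in> Neg ` (A - T). sat M e \<phi>) \<longleftrightarrow> (\<forall>\<phi> \<in> A - T. \<not> sat M e \<phi>)" by simp
      then show ?thesis unfolding ball_Un using T by auto
    qed
    ultimately show ?thesis by simp
  qed
  then obtain d where d: "\<And>T. T \<in> TT \<Longrightarrow> wf_fm L (d T) \<and> fv (d T) \<subseteq> X \<and> quantifiers (d T) = 0 \<and>
    (\<forall>(M :: 'a fo_struct) e. sat M e (d T) \<longleftrightarrow> {\<phi> \<in> A. sat M e \<phi>} = T)" by metis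
  have "finite TT" using TT A(1) finite_subset by blast
  then have "\<exists>\<psi>. wf_fm L \<psi> \<and> fv \<psi> \<subseteq> X \<and> quantifiers \<psi> = 0 \<and>
    (\<forall>(M :: 'a fo_struct) e. sat M e \<psi> \<longleftrightarrow> (\<forall>\<phi> \<in> (\<lambda>T. Neg (d T)) ` TT. sat M e \<phi>))"
    using d by (intro ex_conjunction) auto
  then obtain \<psi> where "wf_fm L \<psi> \<and> fv \<psi> \<subseteq> X \<and> quantifiers \<psi> = 0 \<and>
    (\<forall>(M :: 'a fo_struct) e. sat M e \<psi> \<longleftrightarrow> (\<forall>\<phi> \<in> (\<lambda>T. Neg (d T)) ` TT. sat M e \<phi>))"
    by blast
  with d show ?thesis by (intro exI[of _ "Neg \<psi>"]) auto
qed

text \<open>The fibre sizes on both sides have the same sum, so one-sided inequalities are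
  equalities, and bijections of corresponding fibres can be glued.\<close>

lemma bij_betw_respecting_fibres:
  assumes fin: "finite A" "finite B" and card: "card A = card B"
    and le: "\<And>t. card {b \<in> B. \<beta> b = t} \<le> card {a \<in> A. \<alpha> a = t}"
  shows "\<exists>f. bij_betw f A B \<and> (\<forall>a \<in> A. \<beta> (f a) = \<alpha> a)"
proof -
  let ?T = "\<alpha> ` A \<union> \<beta> ` B"
  have sum: "card A = (\<Sum>t\<in>?T. card {a \<in> A. \<alpha> a = t})" "card B = (\<Sum>t\<in>?T. card {b \<in> B. \<beta> b = t})"
    using fin sum.group[of A ?T \<alpha> "\<lambda>_. 1::nat"] sum.group[of B ?T \<beta> "\<lambda>_. 1::nat"] by auto
  have eq: "card {b \<in> B. \<beta> b = t} = card {a \<in> A. \<alpha> a = t}" for t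
  proof (cases "t \<in> ?T")
    case True
    then show ?thesis
      using sum_mono_inv[of "\<lambda>t. card {b \<in> B. \<beta> b = t}" ?T "\<lambda>t. card {a \<in> A. \<alpha> a = t}" t]
        sum card le fin by auto
  next
    case False
    then have "{b \<in> B. \<beta> b = t} = {}" "{a \<in> A. \<alpha> a = t} = {}" by auto
    then show ?thesis by (metis card.empty)
  qed
  have "\<exists>h. bij_betw h {a \<in> A. \<alpha> a = t} {b \<in> B. \<beta> b = t}" for t
    using fin eq by (intro finite_same_card_bij) auto
  then obtain h where h: "\<And>t. bij_betw (h t) {a \<in> A. \<alpha> a = t} {b \<in> B. \<beta> b = t}" by metis
  have hin: "h (\<alpha> a) a \<in> B \<and> \<beta> (h (\<alpha> a) a) = \<alpha> a" if "a \<in> A" for a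
    using bij_betwE[OF h[of "\<alpha> a"]] that by auto
  have "inj_on (\<lambda>a. h (\<alpha> a) a) A"
  proof (rule inj_onI)
    fix x y assume xy: "x \<in> A" "y \<in> A" "h (\<alpha> x) x = h (\<alpha> y) y"
    then have "\<alpha> x = \<alpha> y" using hin by metis
    then show "x = y" using xy bij_betw_imp_inj_on[OF h[of "\<alpha> x"]] by (auto dest: inj_onD)
  qed
  moreover have "(\<lambda>a. h (\<alpha> a) a) ` A = B"
    using fin card hin card_image[OF calculation] by (intro card_subset_eq) auto
  ultimately show ?thesis using hin by (intro exI[of _ "\<lambda>a. h (\<alpha> a) a"]) (auto simp: bij_betw_def)
qed

section \<open>Types, similarity and bases\<close>

text \<open>The quantifier-free type of \<open>u\<close> over the copy \<open>c ` X\<close> of \<open>X\<close>, with \<open>None\<close> standing for \<open>u\<close>;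
  labelling by \<open>X\<close> rather than by \<open>c ` X\<close> makes types in different structures comparable.\<close>

definition tp :: "nat list \<Rightarrow> 'a fo_struct \<Rightarrow> ('b \<Rightarrow> 'a) \<Rightarrow> 'b set \<Rightarrow> 'a \<Rightarrow> (nat \<times> 'b option list) set" where
  "tp L M c X u = {(i, w). i < length L \<and> length w = L ! i \<and> set w \<subseteq> insert None (Some ` X) \<and>
     map (case_option u c) w \<in> rel M i}"

definition similar :: "nat list \<Rightarrow> 'a fo_struct \<Rightarrow> 'a \<Rightarrow> 'a \<Rightarrow> bool" where
  "similar L M a b \<longleftrightarrow> (\<forall>i < length L. \<forall>w. length w = L ! i \<and> set w \<subseteq> universe M \<longrightarrow>
     (w \<in> rel M i \<longleftrightarrow> map (transpose a b) w \<in> rel M i))"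

definition base :: "nat list \<Rightarrow> 'a fo_struct \<Rightarrow> 'a set \<Rightarrow> bool" where
  "base L M X \<longleftrightarrow> X \<subseteq> universe M \<and> (\<forall>a \<in> universe M - X. \<forall>b \<in> universe M - X.
     tp L M (\<lambda>x. x) X a = tp L M (\<lambda>x. x) X b \<longrightarrow> similar L M a b)"

definition tp_class :: "nat list \<Rightarrow> 'a fo_struct \<Rightarrow> 'a set \<Rightarrow> 'a \<Rightarrow> 'a set" where
  "tp_class L M X a = {v \<in> universe M - X. tp L M (\<lambda>x. x) X v = tp L M (\<lambda>x. x) X a}"

lemma tp_restrict:
  "X \<subseteq> Y \<Longrightarrow> tp L M c X u = {(i, w) \<in> tp L M c Y u. set w \<subseteq> insert None (Some ` X)}"
  by (auto simp: tp_def)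

lemma tp_mono: "X \<subseteq> Y \<Longrightarrow> tp L M c Y a = tp L M c Y b \<Longrightarrow> tp L M c X a = tp L M c X b"
  by (simp add: tp_restrict[of X Y])

lemma base_mono: "base L M X \<Longrightarrow> X \<subseteq> Y \<Longrightarrow> Y \<subseteq> universe M \<Longrightarrow> base L M Y"
  unfolding base_def using tp_mono[of X Y L M "\<lambda>x. x"] by blast

text \<open>The working form of type equality: occurrences of \<open>a\<close> become the
  placeholder \<open>None\<close>, which the two types evaluate at \<open>a\<close> and at
  \<open>b\<close>.\<close>

lemma tp_eq_replace:
  assumes "tp L M (\<lambda>x. x) X a = tp L M (\<lambda>x. x) X b" "i < length L" "length w = L ! i" "set w \<subseteq> insert a X"
  shows "w \<in> rel M i \<longleftrightarrow> map (id(a := b)) w \<in> rel M i"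
proof -
  define w' where "w' = map (\<lambda>x. if x = a then None else Some x) w"
  have a: "map (case_option a (\<lambda>x. x)) w' = w" "map (case_option b (\<lambda>x. x)) w' = map (id(a := b)) w"
    by (auto simp: w'_def intro!: map_idI)
  have w': "length w' = L ! i" "set w' \<subseteq> insert None (Some ` X)"
    using assms by (auto simp: w'_def)
  have "(i, w') \<in> tp L M (\<lambda>x. x) X a \<longleftrightarrow> (i, w') \<in> tp L M (\<lambda>x. x) X b" using assms(1) by simp
  then show ?thesis using assms(2) w' unfolding tp_def by (simp add: a)
qed

lemma similar_imp_tp_eq:
  assumes "similar L M a b" "a \<in> universe M" "X \<subseteq> universe M" "a \<notin> X" "b \<notin> X"
  shows "tp L M (\<lambda>x. x) X a = tp L M (\<lambda>x. x) X b"
proof -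
  have "map (case_option a (\<lambda>x. x)) w \<in> rel M i \<longleftrightarrow> map (case_option b (\<lambda>x. x)) w \<in> rel M i"
    if "i < length L" "length w = L ! i" "set w \<subseteq> insert None (Some ` X)" for i w
  proof -
    have "transpose a b (case_option a (\<lambda>x. x) x) = case_option b (\<lambda>x. x) x" if "x \<in> set w" for x
      using that \<open>set w \<subseteq> _\<close> assms(4,5) by (auto simp: transpose_def)
    then have "map (transpose a b) (map (case_option a (\<lambda>x. x)) w) = map (case_option b (\<lambda>x. x)) w" by simp
    moreover have "set (map (case_option a (\<lambda>x. x)) w) \<subseteq> universe M"
      using that(3) assms(2,3) by (fastforce split: option.split)
    ultimately show ?thesis using assms(1) that unfolding similar_def by (metis length_map)
  qed
  then show ?thesis unfolding tp_def by blast
qed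

text \<open>Over a base, such a map can be unwound into swaps of similar elements, each an
  automorphism; the induction is on the number of moved points.\<close>

lemma base_type_preserving_map:
  assumes "base L M X" "finite S" "S \<subseteq> universe M" "inj_on \<pi> S" "\<pi> ` S \<subseteq> universe M"
    and "\<And>v. v \<in> S \<Longrightarrow> \<pi> v = v \<or> v \<notin> X \<and> \<pi> v \<notin> X \<and> tp L M (\<lambda>x. x) X (\<pi> v) = tp L M (\<lambda>x. x) X v"
    and "i < length L" "length w = L ! i" "set w \<subseteq> S"
  shows "w \<in> rel M i \<longleftrightarrow> map \<pi> w \<in> rel M i"
  using assms(4-6)
proof (induction "card {v \<in> S. \<pi> v \<noteq> v}" arbitrary: \<pi> rule: less_induct)
  case less
  show ?case
  proof (cases "\<exists>v \<in> S. \<pi> v \<noteq> v")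
    case False
    then have "map \<pi> w = w" using assms(9) by (intro map_idI) auto
    then show ?thesis by simp
  next
    case True
    then obtain v where v: "v \<in> S" "\<pi> v \<noteq> v" by blast
    \<comment> \<open>Composing with the automorphism that swaps \<open>v\<close> and \<open>\<pi> v\<close> makes \<open>v\<close> a fixed point.\<close>
    let ?\<pi> = "transpose v (\<pi> v) \<circ> \<pi>"
    have vX: "v \<notin> X" "\<pi> v \<notin> X" "tp L M (\<lambda>x. x) X (\<pi> v) = tp L M (\<lambda>x. x) X v"
      using less.prems(3)[OF v(1)] v(2) by auto
    have V: "v \<in> universe M" "\<pi> v \<in> universe M" using v less.prems(2) assms(3) by auto
    then have sim: "similar L M v (\<pi> v)" using assms(1) vX unfolding base_def by auto
    have \<pi>v: "\<pi> x \<noteq> \<pi> v" if "x \<in> S" "x \<noteq> v" for x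
      using less.prems(1) that v by (auto dest: inj_onD)
    \<comment> \<open>A point fixed by \<open>\<pi>\<close> stays fixed, being neither
      \<open>v\<close> nor, by injectivity, \<open>\<pi> v\<close>.\<close>
    have "{x \<in> S. ?\<pi> x \<noteq> x} \<subset> {x \<in> S. \<pi> x \<noteq> x}"
      using v \<pi>v by (auto simp: transpose_def)
    then have lt: "card {x \<in> S. ?\<pi> x \<noteq> x} < card {x \<in> S. \<pi> x \<noteq> x}"
      using assms(2) by (intro psubset_card_mono) auto
    have "w \<in> rel M i \<longleftrightarrow> map ?\<pi> w \<in> rel M i"
    proof (rule less.hyps[OF lt])
      show "inj_on ?\<pi> S" using less.prems(1) by (intro comp_inj_on inj_on_transpose)
      show "?\<pi> ` S \<subseteq> universe M" using less.prems(2) V by (auto simp: transpose_def)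
      show "?\<pi> x = x \<or> x \<notin> X \<and> ?\<pi> x \<notin> X \<and> tp L M (\<lambda>x. x) X (?\<pi> x) = tp L M (\<lambda>x. x) X x" if "x \<in> S" for x
        using less.prems(3)[OF that] vX \<pi>v[OF that] v by (auto simp: transpose_def)
    qed
    moreover have "map \<pi> w \<in> rel M i \<longleftrightarrow> map ?\<pi> w \<in> rel M i"
    proof -
      have "set (map \<pi> w) \<subseteq> universe M" using less.prems(2) assms(9) by auto
      then show ?thesis using sim assms(7,8) unfolding similar_def
        by (metis length_map map_map)
    qed
    ultimately show ?thesis by simp
  qed
qed

section \<open>From local embeddings to bounds on \<open>BS\<close>\<close>

text \<open>What the universal part of the formula says about a tuple with entries \<open>S\<close>.
  The map goes from \<open>N\<close> back to \<open>M\<close> and inverts \<open>c\<close>.\<close>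

definition local_embedding ::
  "nat list \<Rightarrow> 'a fo_struct \<Rightarrow> 'a fo_struct \<Rightarrow> ('a \<Rightarrow> 'a) \<Rightarrow> 'a set \<Rightarrow> 'a set \<Rightarrow> ('a \<Rightarrow> 'a) \<Rightarrow> bool" where
  "local_embedding L N M c X S \<rho> \<longleftrightarrow>
     inj_on \<rho> (c ` X \<union> S) \<and> \<rho> ` (c ` X \<union> S) \<subseteq> universe M \<and> (\<forall>v \<in> X. \<rho> (c v) = v) \<and>
     (\<forall>i < length L. \<forall>w. length w = L ! i \<and> set w \<subseteq> c ` X \<union> S \<longrightarrow>
        (w \<in> rel N i \<longleftrightarrow> map \<rho> w \<in> rel M i))"

text \<open>The formula guesses a copy of \<open>X\<close> with \<open>card X\<close> existential
  variables; \<open>q\<close> universal ones state that the atomic pattern of all variables also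
  occurs in \<open>M\<close> over \<open>X\<close> itself.\<close>

lemma BS_le_if_local_embeddings:
  fixes M :: "'a fo_struct"
  assumes M: "fo_structure L M" "universe M \<noteq> {}" and X: "X \<subseteq> universe M"
    and iso: "\<And>(N :: 'a fo_struct) c. fo_structure L N \<Longrightarrow> order_of N = order_of M \<Longrightarrow>
      c ` X \<subseteq> universe N \<Longrightarrow>
      (\<And>S. S \<subseteq> universe N \<Longrightarrow> card S \<le> q \<Longrightarrow> \<exists>\<rho>. local_embedding L N M c X S \<rho>) \<Longrightarrow>
      isomorphic L M N"
  shows "BS L M \<le> card X + q"
proof -
  define p where "p = card X"
  have finM: "finite (universe M)" using M by (simp add: fo_structure_def)
  then have "finite X" using X finite_subset by blast
  then obtain x where x: "bij_betw x {..<p} X"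
    using ex_bij_betw_nat_finite[of X] by (auto simp: p_def atLeast0LessThan)
  define A where "A = (\<lambda>(u, v). Eq u v) ` ({..<p+q} \<times> {..<p+q}) \<union>
    (\<Union>i < length L. Rel i ` {vs. set vs \<subseteq> {..<p+q} \<and> length vs = L ! i})"
  have "finite A" unfolding A_def by (auto intro!: finite_lists_length_eq)
  moreover have "\<forall>\<phi> \<in> A. wf_fm L \<phi> \<and> fv \<phi> \<subseteq> {..<p+q} \<and> quantifiers \<phi> = 0"
    unfolding A_def by auto
  \<comment> \<open>The patterns realised in \<open>M\<close> when the first \<open>p\<close>
    variables enumerate \<open>X\<close>.\<close>
  moreover define TT where
    "TT = {{\<phi> \<in> A. sat M e \<phi>} | e. (\<forall>i<p. e i = x i) \<and> (\<forall>i<p+q. e i \<in> universe M)}"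
  moreover have "TT \<subseteq> Pow A" unfolding TT_def by auto
  ultimately obtain \<psi> where \<psi>: "wf_fm L \<psi>" "fv \<psi> \<subseteq> {..<p+q}" "quantifiers \<psi> = 0"
    and sat\<psi>: "\<And>(N :: 'a fo_struct) e. sat N e \<psi> \<longleftrightarrow> {\<phi> \<in> A. sat N e \<phi>} \<in> TT"
    using ex_boolean_combination[of A L "{..<p+q}" TT] by blast
  define \<theta> where "\<theta> = foldr Ex [0..<p] (foldr All [p..<p+q] \<psi>)"
  have closed: "closed_fm L \<theta>"
    using \<psi> by (auto simp: closed_fm_def \<theta>_def fv_foldr_Ex wf_fm_foldr_Ex fv_foldr_All wf_fm_foldr_All)
  then have fv: "fv \<theta> = {}" by (simp add: closed_fm_def)
  have "sat M x \<theta>"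
    unfolding \<theta>_def sat_foldr_Ex sat_foldr_All
  proof (intro exI[of _ x] conjI allI impI)
    show xM: "\<forall>v \<in> set [0..<p]. x v \<in> universe M" using bij_betwE[OF x] X by auto
    fix e assume e: "(\<forall>v\<in>set [p..<p + q]. e v \<in> universe M) \<and> (\<forall>v. v \<notin> set [p..<p + q] \<longrightarrow> e v = x v)"
    then have "\<forall>i<p. e i = x i" by auto
    moreover have "\<forall>i<p+q. e i \<in> universe M"
      using e xM by (metis atLeastLessThan_iff le0 linorder_not_less set_upt)
    ultimately show "sat M e \<psi>" unfolding sat\<psi> TT_def by blast
  qed simp
  then have "true_on M \<theta>" using true_on_closed[OF fv] by blast
  moreover have "isomorphic L M N"
    if N: "fo_structure L N" "order_of N = order_of M" "true_on N \<theta>" for N :: "'a fo_struct"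
  proof -
    have "finite (universe N)" using N by (simp add: fo_structure_def)
    moreover have "universe N \<noteq> {}" using N(2) M(2) finM by (auto simp: order_of_def)
    then obtain u\<^sub>0 where u\<^sub>0: "u\<^sub>0 \<in> universe N" by blast
    obtain c\<^sub>0 where c\<^sub>0: "\<And>v. v < p \<Longrightarrow> c\<^sub>0 v \<in> universe N" and sat: "sat N c\<^sub>0 (foldr All [p..<p+q] \<psi>)"
      using N(3) unfolding true_on_def \<theta>_def sat_foldr_Ex set_upt atLeast0LessThan
      by (meson lessThan_iff)
    define c where "c = c\<^sub>0 \<circ> inv_into {..<p} x"
    have cx: "c (x i) = c\<^sub>0 i" if "i < p" for i
      using that bij_betw_inv_into_left[OF x] by (simp add: c_def)
    have X_eq: "X = x ` {..<p}" using x by (simp add: bij_betw_def)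
    have "c ` X \<subseteq> universe N" unfolding X_eq using cx c\<^sub>0 by auto
    moreover have "\<exists>\<rho>. local_embedding L N M c X S \<rho>" if S: "S \<subseteq> universe N" "card S \<le> q" for S
    proof -
      have "finite S" using S(1) calculation(1) finite_subset by blast
      then obtain h where h: "bij_betw h {..<card S} S"
        using ex_bij_betw_nat_finite[of S] by (auto simp: atLeast0LessThan)
      \<comment> \<open>The copy of \<open>X\<close> comes first, then \<open>S\<close>; spare
        universal slots are padded with \<open>u\<^sub>0\<close>, which exists because the universe
        is nonempty.\<close>
      define e where "e i = (if i < p then c\<^sub>0 i else if i < p + card S then h (i - p)
        else if i < p + q then u\<^sub>0 else c\<^sub>0 i)" for i
      have "sat N e \<psi>"
        using sat unfolding sat_foldr_All
      proof (elim allE[of _ e] mp, intro conjI)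
        have "h j \<in> universe N" if "j < card S" for j using bij_betwE[OF h] S(1) that by auto
        then show "\<forall>v\<in>set [p..<p + q]. e v \<in> universe N" using u\<^sub>0 by (auto simp: e_def)
        show "\<forall>v. v \<notin> set [p..<p + q] \<longrightarrow> e v = c\<^sub>0 v" using S(2) by (auto simp: e_def)
      qed
      then obtain e\<^sub>0 where e\<^sub>0: "\<And>i. i < p \<Longrightarrow> e\<^sub>0 i = x i" "\<And>i. i < p + q \<Longrightarrow> e\<^sub>0 i \<in> universe M"
        and eqA: "{\<phi> \<in> A. sat N e \<phi>} = {\<phi> \<in> A. sat M e\<^sub>0 \<phi>}"
        unfolding sat\<psi> TT_def by blast
      have atom: "sat N e \<phi> \<longleftrightarrow> sat M e\<^sub>0 \<phi>" if "\<phi> \<in> A" for \<phi> using eqA that by blast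
      have eq: "e i = e j \<longleftrightarrow> e\<^sub>0 i = e\<^sub>0 j" if "i < p + q" "j < p + q" for i j
        using atom[of "Eq i j"] that by (auto simp: A_def)
      \<comment> \<open>Which index \<open>g\<close> picks for a value is harmless: the equality
        atoms agree, so indices identified by \<open>e\<close> are identified by
        \<open>e\<^sub>0\<close>.\<close>
      define g where "g = inv_into {..<p+q} e"
      have g: "g u < p + q" "e (g u) = u" if "u \<in> e ` {..<p+q}" for u
        using that inv_into_into[of u e "{..<p+q}"] f_inv_into_f[of u e "{..<p+q}"]
        by (auto simp: g_def)
      define \<rho> where "\<rho> = e\<^sub>0 \<circ> g"
      have \<rho>: "\<rho> (e i) = e\<^sub>0 i" if "i < p + q" for i
        using g[of "e i"] eq that by (simp add: \<rho>_def)
      have sub: "c ` X \<union> S \<subseteq> e ` {..<p+q}"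
      proof -
        have "c ` X \<subseteq> e ` {..<p+q}"
          unfolding X_eq using cx by (auto simp: e_def intro!: image_eqI)
        moreover have "S \<subseteq> e ` {..<p+q}"
        proof
          fix u assume "u \<in> S"
          then obtain j where "j < card S" "h j = u" using h by (force simp: bij_betw_def)
          then show "u \<in> e ` {..<p+q}"
            using S(2) by (intro image_eqI[of _ _ "p + j"]) (auto simp: e_def)
        qed
        ultimately show ?thesis by blast
      qed
      have "inj_on \<rho> (e ` {..<p+q})"
        using \<rho> eq by (auto simp: inj_on_def)
      moreover have "\<rho> ` (e ` {..<p+q}) \<subseteq> universe M" using \<rho> e\<^sub>0 by auto
      moreover have "\<rho> (c v) = v" if v: "v \<in> X" for v
      proof -
        obtain i where i: "i < p" "v = x i" using v X_eq by auto
        then have "c v = e i" using cx by (simp add: e_def)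
        then show ?thesis using \<rho>[of i] e\<^sub>0(1) i by simp
      qed
      moreover have "w \<in> rel N i \<longleftrightarrow> map \<rho> w \<in> rel M i"
        if w: "i < length L" "length w = L ! i" "set w \<subseteq> c ` X \<union> S" for i w
      proof -
        have we: "set w \<subseteq> e ` {..<p+q}" using w(3) sub by blast
        then have "set (map g w) \<subseteq> {..<p+q}" using g by auto
        then have "Rel i (map g w) \<in> A" using w unfolding A_def
          by (intro UnI2 UN_I[of i] imageI) auto
        from atom[OF this] have "map e (map g w) \<in> rel N i \<longleftrightarrow> map e\<^sub>0 (map g w) \<in> rel M i"
          by (simp only: sat.simps)
        moreover have "map e (map g w) = w" using we g by (auto intro!: map_idI)
        ultimately show ?thesis by (simp add: \<rho>_def)
      qed
      ultimately have "local_embedding L N M c X S \<rho>"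
        unfolding local_embedding_def using sub by (meson image_mono inj_on_subset order_trans)
      then show ?thesis by blast
    qed
    ultimately show ?thesis using iso N by blast
  qed
  ultimately have "identifies L \<theta> M" using closed unfolding identifies_def by blast
  moreover have "bernays_schoenfinkel \<theta>"
    unfolding bernays_schoenfinkel_def \<theta>_def using \<psi>(3) by blast
  moreover have "quantifiers \<theta> = card X + q"
    by (simp add: \<theta>_def quantifiers_foldr_Ex quantifiers_foldr_All \<psi>(3) p_def)
  ultimately show ?thesis unfolding BS_def by (intro Least_le) blast
qed

text \<open>As \<open>\<rho>\<close> inverts \<open>c\<close>, an outside point sent into
  \<open>X\<close> would collide with a point of the copy. Types agree because \<open>\<rho>\<close>
  carries evaluation by \<open>u\<close> and \<open>c\<close> to evaluation by
  \<open>\<rho> u\<close> and the identity.\<close>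

lemma local_embedding_tp:
  assumes \<rho>: "local_embedding L N M c X S \<rho>" and u: "u \<in> S" "u \<notin> c ` X"
  shows "\<rho> u \<in> universe M - X" "tp L M (\<lambda>x. x) X (\<rho> u) = tp L N c X u"
proof -
  have "\<rho> u \<in> universe M" using \<rho> u by (auto simp: local_embedding_def)
  moreover have "\<rho> u \<notin> X"
  proof
    assume "\<rho> u \<in> X"
    then have "\<rho> (c (\<rho> u)) = \<rho> u" using \<rho> by (auto simp: local_embedding_def)
    then have "c (\<rho> u) = u"
      using \<rho> u \<open>\<rho> u \<in> X\<close> by (auto simp: local_embedding_def inj_on_def)
    with u \<open>\<rho> u \<in> X\<close> show False by (metis imageI)
  qed
  ultimately show "\<rho> u \<in> universe M - X" by blast
  have "map (case_option (\<rho> u) (\<lambda>x. x)) w \<in> rel M i \<longleftrightarrow> map (case_option u c) w \<in> rel N i"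
    if w: "i < length L" "length w = L ! i" "set w \<subseteq> insert None (Some ` X)" for i w
  proof -
    have "\<rho> (case_option u c x) = case_option (\<rho> u) (\<lambda>x. x) x" if "x \<in> set w" for x
      using that w(3) \<rho> by (auto simp: local_embedding_def)
    then have "map \<rho> (map (case_option u c) w) = map (case_option (\<rho> u) (\<lambda>x. x)) w" by simp
    moreover have "set (map (case_option u c) w) \<subseteq> c ` X \<union> S" using w(3) u by auto
    ultimately show ?thesis using \<rho> w unfolding local_embedding_def by (metis length_map)
  qed
  then show "tp L M (\<lambda>x. x) X (\<rho> u) = tp L N c X u" unfolding tp_def by blast
qed

text \<open>No type class of \<open>N\<close> over the copy exceeds its counterpart in
  \<open>M\<close>, so counting extends \<open>c\<close> to a type-respecting bijection
  \<open>h\<close>. It is an isomorphism since on each tuple \<open>h\<close>, followed by a local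
  embedding, is a type-preserving map of \<open>M\<close> over a base.\<close>

lemma BS_le_if_base:
  fixes M :: "'a fo_struct"
  assumes M: "fo_structure L M" "universe M \<noteq> {}" and base: "base L M X"
    and k: "\<And>l. l \<in> set L \<Longrightarrow> l \<le> q" "1 \<le> q"
    and q: "(\<forall>a \<in> universe M - X. card (tp_class L M X a) < q) \<or>
      (\<forall>a \<in> universe M - X. tp_class L M X a = universe M - X)"
  shows "BS L M \<le> card X + q"
proof (rule BS_le_if_local_embeddings[OF M])
  show X: "X \<subseteq> universe M" using base by (simp add: base_def)
  fix N :: "'a fo_struct" and c
  assume N: "fo_structure L N" "order_of N = order_of M" and c: "c ` X \<subseteq> universe N"
    and emb: "\<And>S. S \<subseteq> universe N \<Longrightarrow> card S \<le> q \<Longrightarrow> \<exists>\<rho>. local_embedding L N M c X S \<rho>"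
  have fin: "finite (universe M)" "finite (universe N)" using M N by (auto simp: fo_structure_def)
  then have finX: "finite X" using X finite_subset by blast
  have injc: "inj_on c X"
    using emb[of "{}"] unfolding local_embedding_def by (metis card.empty empty_subsetI inj_on_inverseI le0)
  have cards: "card (universe M - X) = card (universe N - c ` X)"
    using N(2) X c fin finX by (simp add: order_of_def card_Diff_subset card_image[OF injc])
  have le: "card {u \<in> universe N - c ` X. tp L N c X u = t} \<le> card {v \<in> universe M - X. tp L M (\<lambda>x. x) X v = t}"
    (is "card (?FN t) \<le> card (?FM t)") for t
  proof (cases "?FN t = {}")
    case True
    then show ?thesis by (metis card.empty le0)
  next
    case False
    then obtain u where u: "u \<in> ?FN t" by blast
    \<comment> \<open>One embedded element shows that a type realised in \<open>N\<close> is
      realised in \<open>M\<close>.\<close>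
    with emb[of "{u}"] k(2) obtain \<rho> where "local_embedding L N M c X {u} \<rho>" by auto
    from local_embedding_tp[OF this] u
    have ru: "\<rho> u \<in> universe M - X" "tp L M (\<lambda>x. x) X (\<rho> u) = t" by auto
    then have cls: "?FM t = tp_class L M X (\<rho> u)" by (simp only: tp_class_def)
    from q show ?thesis
    proof
      assume "\<forall>a \<in> universe M - X. tp_class L M X a = universe M - X"
      then have "card (?FM t) = card (universe N - c ` X)" using cls ru(1) cards by simp
      then show ?thesis using fin by (metis (no_types, lifting) card_mono finite_Diff mem_Collect_eq subsetI)
    next
      assume "\<forall>a \<in> universe M - X. card (tp_class L M X a) < q"
      then have small: "card (?FM t) < q" using cls ru(1) by simp
      show ?thesis
      proof (rule ccontr)
        assume "\<not> ?thesis"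
        \<comment> \<open>\<open>S\<close> is one element too large for the class in
          \<open>M\<close>, yet within the limit \<open>q\<close> because that class has fewer than
          \<open>q\<close> elements.\<close>
        then have "Suc (card (?FM t)) \<le> card (?FN t)" by linarith
        then obtain S where S: "S \<subseteq> ?FN t" "card S = Suc (card (?FM t))" "finite S"
          by (rule obtain_subset_with_card_n)
        then have "S \<subseteq> universe N" by auto
        with emb[of S] S(2) small obtain \<rho> where \<rho>: "local_embedding L N M c X S \<rho>" by auto
        have "\<rho> ` S \<subseteq> ?FM t" using local_embedding_tp[OF \<rho>] S(1) by auto
        moreover have "inj_on \<rho> S"
          using \<rho> unfolding local_embedding_def by (meson Un_upper2 inj_on_subset)
        ultimately have "card S \<le> card (?FM t)" using fin by (intro card_inj_on_le) auto
        then show False using S(2) by simp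
      qed
    qed
  qed
  obtain f where f: "bij_betw f (universe M - X) (universe N - c ` X)"
    and ftp: "\<And>v. v \<in> universe M - X \<Longrightarrow> tp L N c X (f v) = tp L M (\<lambda>x. x) X v"
    using bij_betw_respecting_fibres[OF _ _ cards le] fin by auto
  define h where "h v = (if v \<in> X then c v else f v)" for v
  have "bij_betw h (X \<union> (universe M - X)) (c ` X \<union> (universe N - c ` X))"
    unfolding h_def using f injc by (intro bij_betw_disjoint_Un) (auto simp: bij_betw_def)
  then have h: "bij_betw h (universe M) (universe N)"
    using X c by (simp add: Un_absorb1)
  moreover have "w \<in> rel M i \<longleftrightarrow> map h w \<in> rel N i"
    if w: "i < length L" "length w = L ! i" "set w \<subseteq> universe M" for i w
  proof -
    \<comment> \<open>Arities are at most \<open>q\<close>, so one local embedding covers all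
      entries of the tuple.\<close>
    have "card (h ` set w) \<le> q"
      using card_image_le[of "set w" h] card_length[of w] k(1)[of "L ! i"] w by fastforce
    moreover have "h ` set w \<subseteq> universe N" using bij_betwE[OF h] w(3) by auto
    ultimately obtain \<rho> where \<rho>: "local_embedding L N M c X (h ` set w) \<rho>" using emb by meson
    have "w \<in> rel M i \<longleftrightarrow> map (\<rho> \<circ> h) w \<in> rel M i"
    proof (rule base_type_preserving_map[OF base _ w(3) _ _ _ w(1,2)])
      have "inj_on h (set w)" using h w(3) by (meson bij_betw_def inj_on_subset)
      moreover have "inj_on \<rho> (h ` set w)"
        using \<rho> unfolding local_embedding_def by (meson Un_upper2 inj_on_subset)
      ultimately show "inj_on (\<rho> \<circ> h) (set w)" by (rule comp_inj_on)
      show "(\<rho> \<circ> h) ` set w \<subseteq> universe M" using \<rho> by (auto simp: local_embedding_def)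
      fix v assume v: "v \<in> set w"
      show "(\<rho> \<circ> h) v = v \<or> v \<notin> X \<and> (\<rho> \<circ> h) v \<notin> X \<and> tp L M (\<lambda>x. x) X ((\<rho> \<circ> h) v) = tp L M (\<lambda>x. x) X v"
      proof (cases "v \<in> X")
        case True
        then show ?thesis using \<rho> by (simp add: h_def local_embedding_def)
      next
        case False
        then have vM: "v \<in> universe M - X" using v w(3) by auto
        then have "h v \<notin> c ` X" "h v = f v" using bij_betwE[OF f] by (auto simp: h_def)
        with local_embedding_tp[OF \<rho> imageI[OF v]] ftp[OF vM] False show ?thesis by simp
      qed
    qed auto
    also have "\<dots> \<longleftrightarrow> map h w \<in> rel N i"
      using \<rho> w(1,2) unfolding local_embedding_def by (metis Un_upper2 length_map list.set_map map_map)
    finally show ?thesis .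
  qed
  ultimately show "isomorphic L M N" unfolding isomorphic_def by blast
qed

section \<open>Counting type classes\<close>

text \<open>Elements of \<open>X\<close> are not counted, so enlarging \<open>X\<close> may also
  lose classes.\<close>

definition class_count :: "nat list \<Rightarrow> 'a fo_struct \<Rightarrow> 'a set \<Rightarrow> nat" where
  "class_count L M X = card (tp L M (\<lambda>x. x) X ` (universe M - X))"

text \<open>Restriction maps types over \<open>X \<union> A\<close> to types over \<open>X\<close>.
  It is onto since by \<open>survive\<close> no class is swallowed by \<open>A\<close>, and not
  injective because of \<open>a\<close> and \<open>b\<close>.\<close>

lemma class_count_less:
  assumes fin: "finite (universe M)"
    and survive: "\<And>v. v \<in> universe M - X \<Longrightarrow>
      \<exists>v' \<in> universe M - (X \<union> A). tp L M (\<lambda>x. x) X v' = tp L M (\<lambda>x. x) X v"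
    and ab: "a \<in> universe M - (X \<union> A)" "b \<in> universe M - (X \<union> A)"
      "tp L M (\<lambda>x. x) X a = tp L M (\<lambda>x. x) X b" "tp L M (\<lambda>x. x) (X \<union> A) a \<noteq> tp L M (\<lambda>x. x) (X \<union> A) b"
  shows "class_count L M X < class_count L M (X \<union> A)"
proof -
  let ?W = "universe M - (X \<union> A)"
  let ?t = "tp L M (\<lambda>x. x)"
  define g where "g T = {(i, w) \<in> T. set w \<subseteq> insert None (Some ` X)}" for T :: "(nat \<times> 'a option list) set"
  have g: "?t X u = g (?t (X \<union> A) u)" for u
    unfolding g_def by (rule tp_restrict) simp
  have "?t X ` (universe M - X) = ?t X ` ?W"
  proof (intro equalityI image_subsetI)
    show "?t X v \<in> ?t X ` ?W" if "v \<in> universe M - X" for v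
      using survive[OF that] by (metis image_eqI)
  qed auto
  also have "\<dots> = g ` ?t (X \<union> A) ` ?W" by (simp add: g image_image)
  finally have eq: "class_count L M X = card (g ` ?t (X \<union> A) ` ?W)" by (simp add: class_count_def)
  have "\<not> inj_on g (?t (X \<union> A) ` ?W)"
    using ab g unfolding inj_on_def by (metis image_eqI)
  then have "card (g ` ?t (X \<union> A) ` ?W) \<noteq> card (?t (X \<union> A) ` ?W)"
    using fin by (metis eq_card_imp_inj_on finite_Diff finite_imageI)
  moreover have "card (g ` ?t (X \<union> A) ` ?W) \<le> card (?t (X \<union> A) ` ?W)"
    using fin by (intro card_image_le) auto
  ultimately show ?thesis unfolding eq class_count_def[of L M "X \<union> A"] by linarith
qed

text \<open>Among the sets that spend at most \<open>r\<close> new elements per class, one with most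
  classes is taken. If \<open>r\<close> further elements raised the count, the enlarged set would
  still be affordable.\<close>

lemma ex_class_count_maximal:
  assumes fin: "finite (universe M)" and B: "B \<subseteq> universe M"
  shows "\<exists>X. B \<subseteq> X \<and> X \<subseteq> universe M \<and> card (X - B) \<le> r * class_count L M X \<and>
    (\<forall>A \<subseteq> universe M. card A \<le> r \<longrightarrow> class_count L M (X \<union> A) \<le> class_count L M X)"
proof -
  define K where "K = {X. B \<subseteq> X \<and> X \<subseteq> universe M \<and> card (X - B) \<le> r * class_count L M X}"
  have "finite K" unfolding K_def using fin by (auto intro: finite_subset[of _ "Pow (universe M)"])
  moreover have "B \<in> K" using B by (simp add: K_def)
  ultimately have K: "finite (class_count L M ` K)" "class_count L M ` K \<noteq> {}" by auto
  obtain X where X: "X \<in> K" "class_count L M X = Max (class_count L M ` K)"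
    using Max_in[OF K] by auto
  have "class_count L M (X \<union> A) \<le> class_count L M X" if A: "A \<subseteq> universe M" "card A \<le> r" for A
  proof (rule ccontr)
    assume more: "\<not> ?thesis"
    have "finite A" "finite X" using A X fin finite_subset by (auto simp: K_def)
    then have "card ((X \<union> A) - B) \<le> card ((X - B) \<union> A)" by (intro card_mono) auto
    also have "\<dots> \<le> card (X - B) + card A" by (rule card_Un_le)
    also have "\<dots> \<le> r * Suc (class_count L M X)" using X(1) A(2) by (auto simp: K_def)
    also have "\<dots> \<le> r * class_count L M (X \<union> A)" using more by (intro mult_le_mono2) simp
    finally have "X \<union> A \<in> K" using X(1) A(1) by (auto simp: K_def)
    then have "class_count L M (X \<union> A) \<le> class_count L M X" unfolding X(2) using K by (intro Max_ge) auto
    with more show False by simp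
  qed
  with X(1) show ?thesis unfolding K_def by blast
qed

section \<open>Building a small base in stages\<close>

text \<open>Tuples containing \<open>b\<close> but not \<open>a\<close> are covered by exchanging
  \<open>a\<close> and \<open>b\<close>.\<close>

definition distinguishes :: "nat list \<Rightarrow> 'a fo_struct \<Rightarrow> 'a \<Rightarrow> 'a \<Rightarrow> 'a list \<Rightarrow> bool" where
  "distinguishes L M a b w \<longleftrightarrow> set w \<subseteq> universe M \<and> a \<in> set w \<and>
     (\<exists>i < length L. length w = L ! i \<and> (w \<in> rel M i) \<noteq> (map (transpose a b) w \<in> rel M i))"

text \<open>Measures progress: the empty set qualifies once \<open>d\<close> bounds all arities,
  \<open>d = 1\<close> yields a base, and each stage lowers \<open>d\<close> by one.\<close>

definition partial_base :: "nat list \<Rightarrow> 'a fo_struct \<Rightarrow> nat \<Rightarrow> 'a set \<Rightarrow> bool" where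
  "partial_base L M d B \<longleftrightarrow> B \<subseteq> universe M \<and> (\<forall>a \<in> universe M - B. \<forall>b \<in> universe M - B.
     tp L M (\<lambda>x. x) B a = tp L M (\<lambda>x. x) B b \<longrightarrow>
     (\<forall>w. distinguishes L M a b w \<longrightarrow> card (set w - B) \<le> d))"

lemma partial_base_empty:
  assumes "\<And>l. l \<in> set L \<Longrightarrow> l \<le> d"
  shows "partial_base L M d {}"
proof -
  have "card (set w) \<le> d" if "i < length L" "length w = L ! i" for i and w :: "'a list"
    using card_length[of w] assms[of "L ! i"] that by simp
  then show ?thesis by (auto simp: partial_base_def distinguishes_def)
qed

text \<open>The only entry of a distinguishing tuple outside \<open>B\<close> would be
  \<open>a\<close>, so the swap acts as the replacement of \<open>a\<close> by \<open>b\<close>,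
  which equality of types permits.\<close>

lemma partial_base_1_imp_base:
  assumes fin: "finite (universe M)" and pb: "partial_base L M 1 B"
  shows "base L M B"
proof -
  have not_dist: "\<not> distinguishes L M a b w"
    if ab: "a \<in> universe M - B" "b \<in> universe M - B" "tp L M (\<lambda>x. x) B a = tp L M (\<lambda>x. x) B b" for a b w
  proof
    assume dist: "distinguishes L M a b w"
    then have "card (set w - B) \<le> 1" "a \<in> set w - B"
      using pb ab by (auto simp: partial_base_def distinguishes_def)
    then have w: "set w - B = {a}"
      by (metis List.finite_set card_le_Suc0_iff_eq finite_Diff is_singletonI' is_singleton_the_elem
          One_nat_def empty_iff singletonD)
    have "map (transpose a b) w = map (id(a := b)) w"
      using w ab by (auto simp: transpose_def)
    with dist tp_eq_replace[OF ab(3)] w show False by (auto simp: distinguishes_def)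
  qed
  have "similar L M a b"
    if ab: "a \<in> universe M - B" "b \<in> universe M - B" "tp L M (\<lambda>x. x) B a = tp L M (\<lambda>x. x) B b" for a b
    unfolding similar_def
  proof (intro allI impI)
    fix i w assume w: "i < length L" "length w = L ! i \<and> set w \<subseteq> universe M"
    consider "a \<in> set w" | "b \<in> set w" | "a \<notin> set w" "b \<notin> set w" by blast
    then show "w \<in> rel M i \<longleftrightarrow> map (transpose a b) w \<in> rel M i"
    proof cases
      case 1
      then show ?thesis using not_dist[OF ab, of w] w by (auto simp: distinguishes_def)
    next
      case 2
      then show ?thesis using not_dist[OF ab(2,1) ab(3)[symmetric], of w] w
        by (auto simp: distinguishes_def transpose_commute)
    next
      case 3
      then have "map (transpose a b) w = w" by (intro map_idI) (auto simp: transpose_def)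
      then show ?thesis by simp
    qed
  qed
  then show ?thesis using pb unfolding base_def partial_base_def by blast
qed

lemma card_small_tp_classes:
  assumes fin: "finite (universe M)"
  shows "card {v \<in> universe M - X. card (tp_class L M X v) \<le> s} \<le> s * class_count L M X"
proof -
  let ?t = "tp L M (\<lambda>x. x) X"
  let ?Y = "{v \<in> universe M - X. card (tp_class L M X v) \<le> s}"
  let ?T = "?t ` (universe M - X)"
  have "card {v \<in> ?Y. ?t v = t} \<le> s" for t
  proof (cases "{v \<in> ?Y. ?t v = t} = {}")
    case True
    then show ?thesis by (metis card.empty le0)
  next
    case False
    then obtain v where v: "v \<in> ?Y" "?t v = t" by blast
    have "card {v \<in> ?Y. ?t v = t} \<le> card (tp_class L M X v)"
      using fin v by (intro card_mono) (auto simp: tp_class_def)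
    with v show ?thesis by simp
  qed
  then have "(\<Sum>t\<in>?T. card {v \<in> ?Y. ?t v = t}) \<le> card ?T * s"
    using sum_bounded_above[of ?T "\<lambda>t. card {v \<in> ?Y. ?t v = t}" s] by simp
  moreover have "card (\<Union>t\<in>?T. {v \<in> ?Y. ?t v = t}) \<le> (\<Sum>t\<in>?T. card {v \<in> ?Y. ?t v = t})"
    using fin by (intro card_UN_le) auto
  moreover have "(\<Union>t\<in>?T. {v \<in> ?Y. ?t v = t}) = ?Y" by auto
  ultimately show ?thesis by (simp add: class_count_def mult.commute)
qed

text \<open>A distinguishing tuple with too many elements outside \<open>B'\<close> has exactly
  \<open>r + 1\<close> of them and the others in \<open>X\<close>; the choice of \<open>X\<close>
  then lets single elements be replaced until \<open>a\<close> and \<open>b\<close> are exchanged.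
  The cost is at most \<open>r * m\<close> for \<open>X\<close> and \<open>(r + 1) * m\<close> for
  \<open>Y\<close>.\<close>

lemma partial_base_step:
  assumes fin: "finite (universe M)" and pb: "partial_base L M (Suc r) B"
    and m: "\<And>X. X \<subseteq> universe M \<Longrightarrow> class_count L M X \<le> m"
  shows "\<exists>B'. partial_base L M r B' \<and> card B' \<le> card B + (2 * r + 1) * m"
proof -
  let ?t = "tp L M (\<lambda>x. x)"
  let ?V = "universe M"
  have B: "B \<subseteq> ?V" using pb by (simp add: partial_base_def)
  from ex_class_count_maximal[OF fin B, of r L] obtain X
    where X: "B \<subseteq> X" "X \<subseteq> ?V" "card (X - B) \<le> r * class_count L M X"
      and max: "\<And>A. A \<subseteq> ?V \<Longrightarrow> card A \<le> r \<Longrightarrow> class_count L M (X \<union> A) \<le> class_count L M X" by blast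
  \<comment> \<open>The remaining classes can be exhausted neither by \<open>r\<close> added
    elements nor by \<open>r + 1\<close> elements of a tuple.\<close>
  define Y where "Y = {v \<in> ?V - X. card (tp_class L M X v) \<le> Suc r}"
  define B' where "B' = X \<union> Y"
  have B': "B' \<subseteq> ?V" "B \<subseteq> B'" using X by (auto simp: B'_def Y_def)
  have finX: "finite X" "finite B" using finite_subset[OF X(2) fin] finite_subset[OF B fin] by auto
  have "card B' \<le> card X + card Y" unfolding B'_def by (rule card_Un_le)
  also have "card X = card B + card (X - B)" using X(1) finX by (simp add: card_Diff_subset card_mono)
  also have "card Y \<le> Suc r * class_count L M X" unfolding Y_def by (rule card_small_tp_classes[OF fin])
  also have "card B + card (X - B) + Suc r * class_count L M X \<le> card B + (2 * r + 1) * class_count L M X"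
    using X(3) by (simp add: algebra_simps)
  also have "\<dots> \<le> card B + (2 * r + 1) * m" using m[OF X(2)] by (intro add_left_mono mult_le_mono2)
  finally have card: "card B' \<le> card B + (2 * r + 1) * m" by simp
  \<comment> \<open>Otherwise adding \<open>A\<close> would split a class and destroy none, against
    the maximality of \<open>X\<close>.\<close>
  have stable: "?t (X \<union> A) a = ?t (X \<union> A) b"
    if A: "A \<subseteq> ?V - B'" "card A \<le> r" and ab: "a \<in> ?V - B'" "b \<in> ?V - B'" "a \<notin> A" "b \<notin> A" "?t X a = ?t X b"
    for A a b
  proof (rule ccontr)
    assume neq: "\<not> ?thesis"
    have "class_count L M X < class_count L M (X \<union> A)"
    proof (rule class_count_less[OF fin _ _ _ ab(5) neq])
      fix v assume v: "v \<in> ?V - X"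
      show "\<exists>v' \<in> ?V - (X \<union> A). ?t X v' = ?t X v"
      \<comment> \<open>Elements of \<open>Y\<close> survive because \<open>A\<close> avoids
        \<open>B'\<close>; other classes have more than \<open>r\<close> elements.\<close>
      proof (cases "v \<in> Y")
        case True
        then show ?thesis using A(1) v by (auto simp: B'_def)
      next
        case False
        then have "card A < card (tp_class L M X v)" using v A(2) by (simp add: Y_def)
        moreover have "finite A" using A(1) fin finite_subset by blast
        ultimately have "\<not> tp_class L M X v \<subseteq> A" by (metis card_mono leD)
        then show ?thesis by (auto simp: tp_class_def)
      qed
    qed (use ab in \<open>auto simp: B'_def\<close>)
    moreover have "class_count L M (X \<union> A) \<le> class_count L M X" using max A by auto
    ultimately show False by simp
  qed
  have "card (set w - B') \<le> r"
    if ab: "a \<in> ?V - B'" "b \<in> ?V - B'" "?t B' a = ?t B' b" and dist: "distinguishes L M a b w" for a b w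
  proof (rule ccontr)
    assume big: "\<not> ?thesis"
    have tX: "?t X a = ?t X b" by (rule tp_mono[OF _ ab(3)]) (simp add: B'_def)
    have "?t B a = ?t B b" by (rule tp_mono[OF B'(2) ab(3)])
    moreover have "a \<in> ?V - B" "b \<in> ?V - B" using ab(1,2) B' by auto
    ultimately have "card (set w - B) \<le> Suc r" using pb dist unfolding partial_base_def by blast
    \<comment> \<open>At least \<open>r + 1\<close> elements lie outside \<open>B'\<close> and at
      most \<open>r + 1\<close> outside its subset \<open>B\<close>, so the tuple avoids
      \<open>B' - B\<close>.\<close>
    then have "set w - B' = set w - B"
      using big B'(2) by (intro card_seteq) auto
    then have wX: "set w \<subseteq> X \<union> (set w - B')" and cw: "card (set w - B') \<le> Suc r"
      using X(1) \<open>card (set w - B) \<le> Suc r\<close> by auto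
    obtain i where i: "i < length L" "length w = L ! i" "(w \<in> rel M i) \<noteq> (map (transpose a b) w \<in> rel M i)"
      and wV: "set w \<subseteq> ?V" and aw: "a \<in> set w" using dist by (auto simp: distinguishes_def)
    have "a \<noteq> b" using i(3) by auto
    show False
    proof (cases "b \<in> set w")
      case False
      \<comment> \<open>Besides \<open>a\<close> at most \<open>r\<close> elements lie outside
        \<open>B'\<close>, so one replacement suffices.\<close>
      define A where "A = set w - B' - {a}"
      have "card A \<le> r" using cw aw ab(1) by (simp add: A_def card_Diff_singleton)
      then have "?t (X \<union> A) a = ?t (X \<union> A) b"
        using ab wV False tX by (intro stable) (auto simp: A_def)
      then have "w \<in> rel M i \<longleftrightarrow> map (id(a := b)) w \<in> rel M i"
        using i wX by (intro tp_eq_replace) (auto simp: A_def)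
      moreover have "map (id(a := b)) w = map (transpose a b) w"
        using False by (auto simp: transpose_def)
      ultimately show False using i(3) by simp
    next
      case True
      \<comment> \<open>A third element \<open>c\<close> of the class lets the swap of \<open>a\<close> and \<open>b\<close> be performed by three
        replacements of a single element.\<close>
      define D where "D = set w - B' - {a} - {b}"
      have finD: "finite D" by (simp add: D_def)
      have "set w - B' = insert a (insert b D)" "a \<notin> D" "b \<notin> D"
        using aw True ab(1,2) by (auto simp: D_def)
      then have "card (set w - B') = card D + 2" using \<open>a \<noteq> b\<close> finD by simp
      then have cD: "Suc (card D) \<le> r" using cw by simp
      have "card (insert a (insert b D)) \<le> Suc r"
        using cD finD by (simp add: card_insert_if)
      also have "Suc r < card (tp_class L M X a)" using ab(1) by (auto simp: B'_def Y_def)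
      finally have "\<not> tp_class L M X a \<subseteq> insert a (insert b D)"
        using finD by (metis card_mono finite_insert leD)
      then obtain c where c: "c \<in> tp_class L M X a" "c \<noteq> a" "c \<noteq> b" "c \<notin> D" by blast
      \<comment> \<open>The class of \<open>c\<close> is the large class of \<open>a\<close>, so
        \<open>c\<close> is not in \<open>Y\<close>; were \<open>c\<close> in the tuple, it would
        lie in \<open>D\<close>.\<close>
      then have "tp_class L M X c = tp_class L M X a" by (simp add: tp_class_def)
      then have cV: "c \<in> ?V - B'" and tc: "?t X c = ?t X a"
        using c ab(1) by (auto simp: B'_def Y_def tp_class_def)
      have cw: "c \<notin> set w" using c cV by (auto simp: D_def)
      \<comment> \<open>While \<open>x\<close> is replaced by \<open>y\<close>, the third element
        \<open>z\<close> may occur in the tuple, so it is added to \<open>D\<close>; there is room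
        because \<open>D\<close> has fewer than \<open>r\<close> elements.\<close>
      have step: "?t (X \<union> insert z D) x = ?t (X \<union> insert z D) y"
        if "{x, y, z} = {a, b, c}" "x \<noteq> z" "y \<noteq> z" for x y z
      proof (rule stable)
        have "x \<in> {a, b, c}" "y \<in> {a, b, c}" "z \<in> {a, b, c}" using that(1) by auto
        then show "insert z D \<subseteq> ?V - B'" "x \<in> ?V - B'" "y \<in> ?V - B'" "x \<notin> insert z D"
          "y \<notin> insert z D" "?t X x = ?t X y"
          using ab cV tX tc wV that c by (auto simp: D_def)
        show "card (insert z D) \<le> r" using cD finD by (simp add: card_insert_if)
      qed
      define w1 where "w1 = map (id(a := c)) w"
      define w2 where "w2 = map (id(b := a)) w1"
      have "w \<in> rel M i \<longleftrightarrow> w1 \<in> rel M i" unfolding w1_def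
        using step[of a c b] i(1,2) wX \<open>a \<noteq> b\<close> c by (intro tp_eq_replace) (auto simp: D_def)
      also have "\<dots> \<longleftrightarrow> w2 \<in> rel M i" unfolding w2_def
        using step[of b a c] i(1,2) wX \<open>a \<noteq> b\<close> c by (intro tp_eq_replace) (auto simp: D_def w1_def)
      also have "\<dots> \<longleftrightarrow> map (id(c := b)) w2 \<in> rel M i"
        using step[of c b a] i(1,2) wX \<open>a \<noteq> b\<close> c by (intro tp_eq_replace) (auto simp: D_def w1_def w2_def)
      also have "map (id(c := b)) w2 = map (transpose a b) w"
        using cw c \<open>a \<noteq> b\<close> by (auto simp: w1_def w2_def transpose_def)
      finally show False using i(3) by simp
    qed
  qed
  then have "partial_base L M r B'" using B' unfolding partial_base_def by blast
  with card show ?thesis by blast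
qed

text \<open>The stage from \<open>r + 1\<close> to \<open>r\<close> costs
  \<open>(2 * r + 1) * m\<close>, the difference of two consecutive squares times \<open>m\<close>,
  so the costs telescope.\<close>

lemma ex_small_base:
  assumes fin: "finite (universe M)" and k: "\<And>l. l \<in> set L \<Longrightarrow> l \<le> k" "1 \<le> k"
    and m: "\<And>X. X \<subseteq> universe M \<Longrightarrow> class_count L M X \<le> m"
  shows "\<exists>B. base L M B \<and> card B + m \<le> k\<^sup>2 * m"
proof -
  \<comment> \<open>Writing \<open>1\<^sup>2\<close> makes this the instance \<open>r = 1\<close> of
    the invariant for the downward induction from \<open>k\<close>.\<close>
  have "\<exists>B. partial_base L M 1 B \<and> card B + 1\<^sup>2 * m \<le> k\<^sup>2 * m"
    using k(2)
  proof (induction rule: inc_induct)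
    case base
    show ?case using partial_base_empty[OF k(1)] by (intro exI[of _ "{}"]) auto
  next
    case (step r)
    then obtain B where "partial_base L M (Suc r) B" and B: "card B + (Suc r)\<^sup>2 * m \<le> k\<^sup>2 * m" by blast
    from partial_base_step[OF fin this(1) m] obtain B'
      where "partial_base L M r B'" "card B' \<le> card B + (2 * r + 1) * m" by blast
    with B show ?case by (intro exI[of _ B']) (auto simp: power2_eq_square algebra_simps)
  qed
  then show ?thesis using partial_base_1_imp_base[OF fin] by auto
qed

section \<open>Two further bases and the empty structure\<close>

text \<open>One representative of each type over \<open>X\<close> is left out of \<open>B\<close>.
  As \<open>X \<subseteq> B\<close>, representatives keep distinct types over \<open>B\<close>, so
  the base condition only compares an element with itself.\<close>

lemma ex_transversal_base:
  assumes fin: "finite (universe M)" and X: "X \<subseteq> universe M"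
  shows "\<exists>B. base L M B \<and> card B + class_count L M X = card (universe M) \<and>
    (\<forall>a \<in> universe M - B. card (tp_class L M B a) \<le> 1)"
proof -
  let ?t = "tp L M (\<lambda>x. x)"
  obtain T where T: "T \<subseteq> universe M - X" "inj_on (?t X) T" "?t X ` (universe M - X) = ?t X ` T"
    using subset_image_inj[of "?t X ` (universe M - X)" "?t X" "universe M - X"] by auto
  define B where "B = universe M - T"
  have TV: "T \<subseteq> universe M" "universe M - B = T" "X \<subseteq> B" using T(1) X by (auto simp: B_def)
  have inj: "a = b" if "a \<in> T" "b \<in> T" "?t B a = ?t B b" for a b
    using tp_mono[OF TV(3) that(3)] that T(2) by (auto dest: inj_onD)
  have "similar L M a a" for a by (simp add: similar_def)
  then have "base L M B" unfolding base_def TV(2) using inj by (auto simp: B_def)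
  moreover have "card B + class_count L M X = card (universe M)"
    unfolding class_count_def T(3) card_image[OF T(2)] B_def
    using TV(1) fin by (simp add: card_Diff_subset finite_subset card_mono)
  moreover have "card (tp_class L M B a) \<le> 1" if "a \<in> universe M - B" for a
  proof -
    have "tp_class L M B a \<subseteq> {a}" using that inj unfolding tp_class_def TV(2) by blast
    then show ?thesis using card_mono[of "{a}"] by simp
  qed
  ultimately show ?thesis by blast
qed

text \<open>By the base property the class consists of pairwise similar elements, and swapping two
  of them fixes its complement. This supplies the single-class case of
  \<open>BS_le_if_base\<close>.\<close>

lemma tp_class_outside_tp_class:
  assumes base: "base L M B" and a: "a \<in> universe M - B" and b: "b \<in> tp_class L M B a"
  shows "tp_class L M (universe M - tp_class L M B a) b = tp_class L M B a"
proof -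
  let ?K = "tp_class L M B a"
  have K: "?K \<subseteq> universe M" by (auto simp: tp_class_def)
  have "tp L M (\<lambda>x. x) (universe M - ?K) c = tp L M (\<lambda>x. x) (universe M - ?K) b" if c: "c \<in> ?K" for c
  proof (rule similar_imp_tp_eq)
    show "similar L M c b" using base b c unfolding base_def tp_class_def by auto
  qed (use b c K in auto)
  then show ?thesis using K by (auto simp: tp_class_def[of L M "universe M - ?K"])
qed

text \<open>Positive arities leave no tuples over an empty universe, so all structures of order 0
  are isomorphic and a quantifier-free truth identifies \<open>M\<close>.\<close>

lemma BS_order_0:
  fixes M :: "'a fo_struct"
  assumes L: "vocabulary L" and M: "fo_structure L M" "order_of M = 0"
  shows "BS L M = 0"
proof -
  have empty: "universe N = {}" if "fo_structure L N" "order_of N = 0" for N :: "'a fo_struct"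
    using that by (simp add: fo_structure_def order_of_def)
  have "isomorphic L M N" if "fo_structure L N" "order_of N = 0" for N :: "'a fo_struct"
  proof -
    have pos: "L ! i \<noteq> 0" if "i < length L" for i
      using L nth_mem[OF that] by (auto simp: vocabulary_def)
    show ?thesis using empty[OF that] empty[OF M] by (auto simp: isomorphic_def bij_betw_def dest: pos)
  qed
  then have "identifies L (Neg FF) M"
    using M by (auto simp: identifies_def closed_fm_def true_on_def)
  moreover have "bernays_schoenfinkel (Neg FF)"
    unfolding bernays_schoenfinkel_def by (intro exI[of _ "[]"] exI[of _ "Neg FF"]) simp
  moreover have "quantifiers (Neg FF) = 0" by simp
  ultimately have "BS L M \<le> 0" unfolding BS_def by (intro Least_le) blast
  then show ?thesis by simp
qed

section \<open>Combining the three bounds\<close>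

theorem theorem5p1:
  fixes L :: "nat list" and M :: "'a fo_struct" and k n :: nat
  assumes "vocabulary L" and "L \<noteq> []" and "max_arity L = k"
    and "fo_structure L M" and "order_of M = n"
  shows "real (BS L M) < (1 - 1 / (2 * (real k)\<^sup>2 + 2)) * real n + real k
    \<and> (k = 1 \<longrightarrow> real (BS L M) \<le> real n / 2 + 1)"
proof -
  let ?V = "universe M"
  have k: "l \<le> k" if "l \<in> set L" for l using assms(3) that by (auto simp: max_arity_def)
  have "k \<in> set L" using assms(2,3) Max_in[of "set L"] by (simp add: max_arity_def)
  then have k1: "1 \<le> k" using assms(1) by (auto simp: vocabulary_def Suc_le_eq)
  show ?thesis
  proof (cases "n = 0")
    case True
    then show ?thesis using BS_order_0[OF assms(1,4)] assms(5) k1 by simp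
  next
    case False
    have fin: "finite ?V" and n: "card ?V = n" using assms by (auto simp: fo_structure_def order_of_def)
    then have V: "?V \<noteq> {}" using False by auto
    let ?C = "class_count L M ` Pow ?V"
    define m where "m = Max ?C"
    have m: "class_count L M X \<le> m" if "X \<subseteq> ?V" for X
      unfolding m_def using fin that by (intro Max_ge) auto
    have "m \<in> ?C" unfolding m_def using fin by (intro Max_in) auto
    then obtain X where X: "X \<subseteq> ?V" "class_count L M X = m" by auto
    obtain B where B: "base L M B" "card B + m \<le> k\<^sup>2 * m"
      using ex_small_base[OF fin k k1 m] by blast
    then have BV: "B \<subseteq> ?V" by (simp add: base_def)
    \<comment> \<open>The \<open>0\<close> keeps the maximum meaningful when \<open>B\<close> is the
      whole universe.\<close>
    let ?S = "insert 0 ((\<lambda>a. card (tp_class L M B a)) ` (?V - B))"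
    define s where "s = Max ?S"
    have s: "card (tp_class L M B a) \<le> s" if "a \<in> ?V - B" for a
      unfolding s_def using fin that by (intro Max_ge) auto
    have "s \<in> ?S" unfolding s_def using fin by (intro Max_in) auto
    have base_bound: "BS L M \<le> card B + max k (s + 1)"
      using k k1 s by (intro BS_le_if_base[OF assms(4) V B(1)]) (fastforce simp: le_max_iff_disj less_Suc_eq_le)+
    have class_bound: "BS L M + s \<le> n + k"
    \<comment> \<open>For \<open>s = 0\<close> the bound \<open>base_bound\<close> suffices, as
      \<open>max k 1 = k\<close>; otherwise the complement of a largest class serves as
      base.\<close>
    proof (cases "s = 0")
      case True
      then show ?thesis using base_bound k1 card_mono[OF fin BV] n by (simp add: max_def)
    next
      case False
      then obtain a where a: "a \<in> ?V - B" "s = card (tp_class L M B a)" using \<open>s \<in> ?S\<close> by auto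
      let ?K = "tp_class L M B a"
      have K: "?K \<subseteq> ?V" "B \<subseteq> ?V - ?K" using BV by (auto simp: tp_class_def)
      have "BS L M \<le> card (?V - ?K) + k"
      proof (rule BS_le_if_base[OF assms(4) V _ k k1 disjI2])
        show "base L M (?V - ?K)" by (rule base_mono[OF B(1) K(2)]) auto
        show "\<forall>b \<in> ?V - (?V - ?K). tp_class L M (?V - ?K) b = ?V - (?V - ?K)"
          using tp_class_outside_tp_class[OF B(1) a(1)] K(1) by (simp add: double_diff)
      qed
      moreover have "card (?V - ?K) + s = n"
        using card_mono[OF fin K(1)] K(1) fin n a(2) by (simp add: card_Diff_subset finite_subset)
      ultimately show ?thesis by simp
    qed
    show ?thesis
    proof (cases "k = 1")
      case True
      \<comment> \<open>Here \<open>card B + m \<le> m\<close> makes \<open>B\<close> empty; adding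
        this bound to \<open>class_bound\<close> cancels \<open>s\<close>.\<close>
      then have "BS L M \<le> s + 1" using base_bound B(2) by simp
      then have "real (BS L M) \<le> real n / 2 + 1" using class_bound True by simp
      then show ?thesis using True False by (simp add: field_simps)
    next
      case False
      then have k2: "2 \<le> k" using k1 by simp
      obtain B' where base': "base L M B'" and B': "card B' + m = n"
        and le1: "\<forall>a \<in> ?V - B'. card (tp_class L M B' a) \<le> 1"
        using ex_transversal_base[OF fin X(1), of L] X(2) n by auto
      have "card (tp_class L M B' a) < k" if "a \<in> ?V - B'" for a
        using bspec[OF le1 that] k2 by linarith
      then have "BS L M \<le> card B' + k"
        by (intro BS_le_if_base[OF assms(4) V base' k k1] disjI1 ballI)
      then have transversal_bound: "BS L M + m \<le> n + k" using B' by simp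
      \<comment> \<open>The saving to be shown: \<open>x\<close> solves
        \<open>(k\<^sup>2 + 1) * x = n / 2\<close>, so \<open>m \<le> x\<close> forces
        \<open>card B \<le> (k\<^sup>2 - 1) * x = n / 2 - 2 * x\<close>.\<close>
      define x where "x = real n / (2 * (real k)\<^sup>2 + 2)"
      have pos: "2 * (real k)\<^sup>2 + 2 > 0" by (simp add: add_nonneg_pos)
      then have x: "(real k)\<^sup>2 * x = real n / 2 - x" "x > 0"
        using \<open>n \<noteq> 0\<close> by (auto simp: x_def field_simps)
      have "real (BS L M) < real n - x + real k"
      proof (rule ccontr)
        assume not_less: "\<not> ?thesis"
        have mx: "real m \<le> x" and sx: "real s \<le> x"
          using not_less transversal_bound class_bound by linarith+
        have "real (card B) + real m \<le> (real k)\<^sup>2 * real m"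
          using B(2) by (metis of_nat_add of_nat_le_iff of_nat_mult of_nat_power)
        moreover have "((real k)\<^sup>2 - 1) * real m \<le> ((real k)\<^sup>2 - 1) * x"
          using mx k1 by (intro mult_left_mono) auto
        ultimately have "real (card B) \<le> real n / 2 - 2 * x" using x(1) by (simp add: algebra_simps)
        \<comment> \<open>If the maximum is \<open>k\<close>, the total is at most
          \<open>n / 2 - 2 * x + k\<close>; if it is \<open>s + 1\<close>, then
          \<open>s \<le> x\<close> gives at most \<open>n / 2 - x + 1\<close>. Both are below
          \<open>n - x + k\<close>.\<close>
        moreover have "real (BS L M) \<le> real (card B) + max (real k) (real s + 1)"
          using base_bound by (simp add: max_def split: if_splits)
        ultimately show False using not_less sx x(2) k2 by (simp add: max_def split: if_splits)
      qed
      moreover have "(1 - 1 / (2 * (real k)\<^sup>2 + 2)) * real n = real n - x"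
        by (simp add: x_def algebra_simps)
      ultimately show ?thesis using False by simp
    qed
  qed
qed

end
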